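(* Define $\overline{H}(\Delta) := \sum_{\ell=1}^K H\big(\lfloor Y_\ell/\delta + U_\ell\rceil \,\big|\, U_\ell\big)$. Then for $0<\Delta<1/6$, $$\overline{H}(\Delta) = \sum_{\ell=1}^K\Big[ h\big(s\star u_{\sqrt{12\gamma}\,\pi\ell/K}\big) - \log\frac{\pi\ell\sqrt{12\gamma}}{K}\Big],$$ and consequently $$\lim_{\Delta\to0^+}\Delta\cdot\overline{H}(\Delta) = \frac{2}{\pi^2}\left(\int_0^1 h\big(s\star u_{\pi x\sqrt{12\gamma}}\big)\,dx - \log\big(\pi\sqrt{12\gamma}/e\big)\right).$$
   Context: Let $U$ be uniformly distributed on $[0,1]$ and let the sawbridge be $X(t) = t-\mathbf{1}(t\ge U)$, $t\in[0,1]$. Let $\phi_k(t)=\sqrt2\sin(\pi k t)$ and $Y_k = \int_0^1 X(t)\phi_k(t)\,dt$. Let $\gamma>0$ be the unique solution of $\arctan(\pi\sqrt{\gamma}) = \frac{1}{\pi\sqrt{\gamma}}$. Given $\Delta$, set $D = \frac{\Delta^2\pi^2}{4}$, $K = \big\lceil \frac{1}{\pi\sqrt D}\big\rceil$, and $\delta = \frac{\sqrt{12\gamma}}{K}$. Let $U_1,\ldots,U_K$ be i.i.d. uniform on $[-1/2,1/2]$, independent of $U$; $\lfloor\cdot\rceil$ denotes rounding to the nearest integer, and $H(\cdot\mid\cdot)$ is conditional (discrete) entropy. $s$ is the arcsine density on $[-\sqrt2,\sqrt2]$, $s(x) = \frac{1}{\pi\sqrt{(\sqrt2-x)(\sqrt2+x)}}$;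 $u_a$ is the uniform density on $[-a/2,a/2]$; $\star$ denotes convolution; $h(\cdot)$ is differential entropy of a density. All logarithms are base 2. *)

theory Defs
  imports "HOL-Probability.Probability"
begin

definition sb_gamma :: real where
  "sb_gamma = (THE g. g > 0 \<and> arctan (pi * sqrt g) = 1 / (pi * sqrt g))"

definition phi :: "nat \<Rightarrow> real \<Rightarrow> real" where
  "phi k t = sqrt 2 * sin (pi * real k * t)"

definition sawbridge :: "real \<Rightarrow> real \<Rightarrow> real" where
  "sawbridge u t = t - (if t \<ge> u then 1 else 0)"

(* KL coefficient Y_k as a function of the jump location u *)
definition Ycoef :: "nat \<Rightarrow> real \<Rightarrow> real" where
  "Ycoef k u = integral {0..1} (\<lambda>t. sawbridge u t * phi k t)"

definition D_of :: "real \<Rightarrow> real" where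
  "D_of \<Delta> = \<Delta>^2 * pi^2 / 4"

definition K_of :: "real \<Rightarrow> nat" where
  "K_of \<Delta> = nat \<lceil>1 / (pi * sqrt (D_of \<Delta>))\<rceil>"

definition delta_of :: "real \<Rightarrow> real" where
  "delta_of \<Delta> = sqrt (12 * sb_gamma) / real (K_of \<Delta>)"

definition joint_UV :: "(real \<times> real) measure" where
  "joint_UV = uniform_measure lborel {0..1} \<Otimes>\<^sub>M uniform_measure lborel {-1/2..1/2}"

definition Hterm :: "real \<Rightarrow> nat \<Rightarrow> real" where
  "Hterm \<Delta> l = prob_space.conditional_entropy joint_UV 2
      (count_space UNIV :: int measure) lborel
      (\<lambda>(u, v). round (Ycoef l u / delta_of \<Delta> + v)) snd"

definition Hbar :: "real \<Rightarrow> real" where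
  "Hbar \<Delta> = (\<Sum>l = 1..K_of \<Delta>. Hterm \<Delta> l)"

definition arcsine_dens :: "real \<Rightarrow> real" where
  "arcsine_dens x = (if - sqrt 2 < x \<and> x < sqrt 2
      then 1 / (pi * sqrt ((sqrt 2 - x) * (sqrt 2 + x))) else 0)"

definition unif_dens :: "real \<Rightarrow> real \<Rightarrow> real" where
  "unif_dens a x = (if - a / 2 \<le> x \<and> x \<le> a / 2 then 1 / a else 0)"

definition conv :: "(real \<Rightarrow> real) \<Rightarrow> (real \<Rightarrow> real) \<Rightarrow> real \<Rightarrow> real" where
  "conv f g x = (\<integral>y. f y * g (x - y) \<partial>lborel)"

(* differential entropy (base 2) of a density; 0 log 0 = 0 *)
definition diff_entropy :: "(real \<Rightarrow> real) \<Rightarrow> real" where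
  "diff_entropy f = - (\<integral>x. f x * log 2 (f x) \<partial>lborel)"

end

theory Submission
  imports Defs "HOL-Real_Asymp.Real_Asymp"
begin

text \<open>
  Integration gives \<open>Y\<^sub>l = - \<surd>2 cos (\<pi> l U) / (\<pi> l)\<close>, and \<open>- \<surd>2 cos (\<pi> l U)\<close> is arcsine distributed for every
  \<open>l \<ge> 1\<close>. With \<open>a = \<pi> l \<delta>\<close>, the quantizer output is \<open>n\<close> given \<open>U\<^sub>l = v\<close> exactly when this variable lies in
  the window of width \<open>a\<close> around \<open>a (n - v)\<close>, an event of probability \<open>w (a (n - v))\<close> where
  \<open>w = a \<cdot> (s \<star> u\<^sub>a)\<close>. As \<open>n\<close> runs over the integers and \<open>v\<close> over a unit interval, \<open>n - v\<close> covers the real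
  line exactly once, so the conditional entropy is \<open>- (\<integral> w log w) / a = h (s \<star> u\<^sub>a) - log a\<close>.

  This quantity is continuous in \<open>a > 0\<close>, nonnegative because \<open>w \<le> 1\<close>, and at most \<open>C - log a\<close> because
  \<open>- y log y\<close> is bounded. Hence the sums over \<open>l\<close>, divided by \<open>K\<close>, are right Riemann sums dominated by an
  integrable decreasing function, and \<open>\<Delta> K \<longrightarrow> 2 / \<pi>\<^sup>2\<close>.
\<close>

subsection \<open>The arcsine distribution\<close>

text \<open>A definite description yields nothing before existence and uniqueness are known. With y
  = pi sqrt g the equation reads y arctan y = 1, whose left side increases strictly on y > 0, so
  exactly one g exists and it is positive. This makes the step size \<open>delta_of\<close>
  positive.\<close>

lemma sb_gamma_pos: "sb_gamma > 0"
proof -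
  define f :: "real \<Rightarrow> real" where "f y = y * arctan y" for y
  have mono: "f x < f y" if "0 < x" "x < y" for x y
    unfolding f_def using that by (intro mult_strict_mono) (auto simp: arctan_less_iff)
  have "\<exists>y\<ge>0. y \<le> 2 \<and> f y = 1"
  proof (rule IVT')
    have "arctan 1 < arctan (2::real)"
      by (simp only: arctan_less_iff)
    \<comment> \<open>2 arctan 2 > 2 arctan 1 = pi/2 > 1.\<close>
    then show "1 \<le> f 2"
      using pi_gt3 by (simp add: f_def arctan_one)
  qed (auto simp: f_def intro!: continuous_intros)
  then obtain y where y: "y > 0" "f y = 1"
    by (metis f_def mult_zero_left order_le_less zero_neq_one)
  have iff: "(g > 0 \<and> arctan (pi * sqrt g) = 1 / (pi * sqrt g)) \<longleftrightarrow> g = (y / pi)\<^sup>2" for g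
  proof
    assume g: "g > 0 \<and> arctan (pi * sqrt g) = 1 / (pi * sqrt g)"
    define z where "z = pi * sqrt g"
    have z: "z > 0" "f z = 1"
      using g by (auto simp: z_def f_def)
    have "z = y"
      using mono[of z y] mono[of y z] y z by (cases z y rule: linorder_cases) auto
    moreover have "(z / pi)\<^sup>2 = g"
      using g by (simp add: z_def)
    ultimately show "g = (y / pi)\<^sup>2"
      by simp
  next
    assume g: "g = (y / pi)\<^sup>2"
    then have "pi * sqrt g = y"
      using y by simp
    moreover have "arctan y = 1 / y"
      using y by (simp add: f_def field_simps)
    moreover have "g > 0"
      using y g by simp
    ultimately show "g > 0 \<and> arctan (pi * sqrt g) = 1 / (pi * sqrt g)"
      by simp
  qed
  have "sb_gamma = (y / pi)\<^sup>2"
    unfolding sb_gamma_def iff by simp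
  moreover have "(y / pi)\<^sup>2 > 0"
    using y by simp
  ultimately show ?thesis
    by metis
qed

text \<open>Clamping keeps \<open>arcsin\<close> inside [-1, 1], where it is specified, and gives
  the values 0 and 1 outside the support. The function is thus continuous on the whole line.\<close>

definition arcsine_cdf :: "real \<Rightarrow> real" where
  "arcsine_cdf x = 1 / 2 + arcsin (max (-1) (min 1 (x / sqrt 2))) / pi"

lemma continuous_on_arcsine_cdf [continuous_intros]:
  assumes "continuous_on S f"
  shows "continuous_on S (\<lambda>x. arcsine_cdf (f x))"
  unfolding arcsine_cdf_def by (intro continuous_intros assms) auto

lemma arcsine_cdf_mono: "x \<le> y \<Longrightarrow> arcsine_cdf x \<le> arcsine_cdf y"
  unfolding arcsine_cdf_def
  by (intro add_left_mono divide_right_mono arcsin_le_arcsin max.mono min.mono) auto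

lemma arcsine_cdf_eq_0: "x \<le> - sqrt 2 \<Longrightarrow> arcsine_cdf x = 0"
proof -
  assume "x \<le> - sqrt 2"
  then have "x / sqrt 2 \<le> -1" by (simp add: field_simps)
  then have "max (-1) (min 1 (x / sqrt 2)) = -1" by simp
  then show ?thesis by (simp only: arcsine_cdf_def) simp
qed

lemma arcsine_cdf_eq_1: "x \<ge> sqrt 2 \<Longrightarrow> arcsine_cdf x = 1"
proof -
  assume "x \<ge> sqrt 2"
  then have "x / sqrt 2 \<ge> 1" by (simp add: field_simps)
  then have "max (-1) (min 1 (x / sqrt 2)) = 1" by simp
  then show ?thesis by (simp only: arcsine_cdf_def) simp
qed

lemma arcsine_cdf_nonneg: "0 \<le> arcsine_cdf x"
  by (cases "x \<le> - sqrt 2")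
     (use arcsine_cdf_mono[of "- sqrt 2" x] in \<open>auto simp: arcsine_cdf_eq_0\<close>)

lemma arcsine_cdf_le_1: "arcsine_cdf x \<le> 1"
  by (cases "x \<ge> sqrt 2")
     (use arcsine_cdf_mono[of x "sqrt 2"] in \<open>auto simp: arcsine_cdf_eq_1\<close>)

lemma arcsine_dens_nonneg: "0 \<le> arcsine_dens x"
  by (simp add: arcsine_dens_def)

lemma borel_measurable_arcsine_dens [measurable]: "arcsine_dens \<in> borel_measurable borel"
  unfolding arcsine_dens_def by measurable

lemma DERIV_arcsine_cdf:
  assumes "x \<notin> {- sqrt 2, sqrt 2}"
  shows "(arcsine_cdf has_real_derivative arcsine_dens x) (at x)"
proof -
  consider "x < - sqrt 2" | "- sqrt 2 < x" "x < sqrt 2" | "x > sqrt 2"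
    using assms by fastforce
  then show ?thesis
  proof cases
    case 1
    have "(arcsine_cdf has_real_derivative 0) (at x)"
      by (rule has_field_derivative_transform_within_open[where f = "\<lambda>_. 0" and S = "{..<- sqrt 2}"])
         (use 1 in \<open>auto simp: arcsine_cdf_eq_0\<close>)
    then show ?thesis using 1 by (simp add: arcsine_dens_def)
  next
    case 2
    have bd: "-1 < x / sqrt 2" "x / sqrt 2 < 1" using 2 by (auto simp: field_simps)
    have sqrt2: "sqrt 2 / (t * (2 * pi)) = 1 / (t * sqrt 2 * pi)" for t :: real
      by (cases "t = 0") (auto simp: field_simps)
    have "((\<lambda>x. 1 / 2 + arcsin (x / sqrt 2) / pi) has_real_derivative
        (1 / sqrt (1 - (x / sqrt 2)\<^sup>2)) / sqrt 2 / pi) (at x)"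
      using bd by (auto intro!: derivative_eq_intros simp: inverse_eq_divide sqrt2)
    moreover have "sqrt (1 - (x / sqrt 2)\<^sup>2) * sqrt 2 = sqrt ((sqrt 2 - x) * (sqrt 2 + x))"
      by (simp flip: real_sqrt_mult) (simp add: field_simps power2_eq_square)
    ultimately have "((\<lambda>x. 1 / 2 + arcsin (x / sqrt 2) / pi) has_real_derivative arcsine_dens x) (at x)"
      using 2 by (simp add: arcsine_dens_def mult_ac)
    then show ?thesis
    proof (rule has_field_derivative_transform_within_open[where S = "{- sqrt 2<..<sqrt 2}"])
      fix y assume "y \<in> {- sqrt 2<..<sqrt 2}"
      then have "max (-1) (min 1 (y / sqrt 2)) = y / sqrt 2" by (auto simp: field_simps)
      then show "1 / 2 + arcsin (y / sqrt 2) / pi = arcsine_cdf y"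
        by (simp only: arcsine_cdf_def)
    qed (use 2 in auto)
  next
    case 3
    have "(arcsine_cdf has_real_derivative 0) (at x)"
      by (rule has_field_derivative_transform_within_open[where f = "\<lambda>_. 1" and S = "{sqrt 2<..}"])
         (use 3 in \<open>auto simp: arcsine_cdf_eq_1\<close>)
    then show ?thesis using 3 by (simp add: arcsine_dens_def)
  qed
qed

text \<open>The density blows up at the two ends of its support, but this form of the fundamental
  theorem asks only for continuity of the antiderivative at finitely many exceptional points, so no
  improper limits arise.\<close>

lemma has_integral_arcsine_dens:
  "p \<le> q \<Longrightarrow> (arcsine_dens has_integral arcsine_cdf q - arcsine_cdf p) {p..q}"
  by (rule fundamental_theorem_of_calculus_interior_strong[where S = "{- sqrt 2, sqrt 2}"])
     (auto intro!: continuous_intros DERIV_arcsine_cdf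
       simp flip: has_real_derivative_iff_has_vector_derivative)

text \<open>Mass of the arcsine law on the interval of length a centred at x. For a >= 0 it lies in
  [0, 1] and, unlike \<open>arcsine_dens\<close>, it is continuous.\<close>

definition arcsine_window :: "real \<Rightarrow> real \<Rightarrow> real" where
  "arcsine_window a x = arcsine_cdf (x + a / 2) - arcsine_cdf (x - a / 2)"

lemma conv_arcsine_unif:
  assumes "a > 0"
  shows "conv arcsine_dens (unif_dens a) x = arcsine_window a x / a"
proof -
  let ?f = "\<lambda>y. arcsine_dens y * unif_dens a (x - y)"
  have "((\<lambda>y. arcsine_dens y * (1 / a)) has_integral arcsine_window a x * (1 / a)) {x - a / 2..x + a / 2}"
    unfolding arcsine_window_def using assms by (intro has_integral_mult_left has_integral_arcsine_dens) auto
  then have "(?f has_integral arcsine_window a x / a) UNIV"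
    by (subst (asm) has_integral_restrict_UNIV[symmetric])
       (auto simp: unif_dens_def algebra_simps elim!: has_integral_eq[rotated])
  moreover have "?f \<in> borel_measurable borel"
    unfolding unif_dens_def by measurable
  moreover have nn: "0 \<le> ?f y" for y
    using assms by (simp add: arcsine_dens_nonneg unif_dens_def)
  \<comment> \<open>A nonnegative measurable integrand has the same gauge and Lebesgue integral,
    even though it may be unbounded here.\<close>
  ultimately have "(\<integral>\<^sup>+y. ?f y \<partial>lborel) = arcsine_window a x / a"
    by (intro nn_integral_has_integral_lborel)
  moreover have "0 \<le> arcsine_window a x"
    unfolding arcsine_window_def using assms by (simp add: arcsine_cdf_mono)
  ultimately show ?thesis
    unfolding conv_def using assms nn \<open>?f \<in> borel_measurable borel\<close>
    by (subst integral_eq_nn_integral) auto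
qed

text \<open>The minima cover jumps outside [0, 1] as well: the formula holds for every real u, so
  measurability of \<open>Ycoef l\<close> on the whole line can be read off from it.\<close>

lemma Ycoef_eq:
  assumes "l > 0"
  defines "k \<equiv> pi * real l"
  shows "Ycoef l u = sqrt 2 / k * (cos (k * min u 0) - 1 - cos (k * min u 1))"
proof -
  \<comment> \<open>The first two terms are an antiderivative of t sin(k t). The last subtracts the
    integral of sin(k s) from min u t to t, which is 0 until the jump. Hence F is continuous, with a
    possible kink only at u.\<close>
  define F where "F t = - t * cos (k * t) / k + sin (k * t) / k\<^sup>2 - (cos (k * min u t) - cos (k * t)) / k" for t
  have k: "k > 0" using assms by simp
  have "((\<lambda>t. sawbridge u t * sin (k * t)) has_integral F 1 - F 0) {0..1}"
  proof (rule fundamental_theorem_of_calculus_interior_strong[where S = "{u}"])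
    fix t assume t: "t \<in> {0<..<1} - {u}"
    have D: "((\<lambda>t. - t * cos (k * t) / k + sin (k * t) / k\<^sup>2) has_real_derivative t * sin (k * t)) (at t)"
      using k by (auto intro!: derivative_eq_intros simp: field_simps power2_eq_square)
    have "(F has_real_derivative sawbridge u t * sin (k * t)) (at t)"
    proof (cases "t < u")
      case True
      from D have "(F has_real_derivative t * sin (k * t)) (at t)"
        by (rule has_field_derivative_transform_within_open[where S = "{..<u}"])
           (use True in \<open>auto simp: F_def\<close>)
      then show ?thesis using True by (simp add: sawbridge_def)
    next
      case False
      have "((\<lambda>t. - t * cos (k * t) / k + sin (k * t) / k\<^sup>2 - (cos (k * u) - cos (k * t)) / k)
          has_real_derivative t * sin (k * t) - sin (k * t)) (at t)"
        by (rule DERIV_diff[OF D]) (use k in \<open>auto intro!: derivative_eq_intros\<close>)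
      then have "(F has_real_derivative t * sin (k * t) - sin (k * t)) (at t)"
        by (rule has_field_derivative_transform_within_open[where S = "{u<..}"])
           (use False t in \<open>auto simp: F_def\<close>)
      then show ?thesis using False by (simp add: sawbridge_def algebra_simps)
    qed
    then show "(F has_vector_derivative sawbridge u t * sin (k * t)) (at t)"
      by (simp flip: has_real_derivative_iff_has_vector_derivative)
  qed (use k in \<open>auto simp: F_def intro!: continuous_intros\<close>)
  then have "((\<lambda>t. sqrt 2 * (sawbridge u t * sin (k * t))) has_integral sqrt 2 * (F 1 - F 0)) {0..1}"
    by (rule has_integral_mult_right)
  then have "Ycoef l u = sqrt 2 * (F 1 - F 0)"
    unfolding Ycoef_def phi_def by (intro integral_unique) (simp add: k_def mult_ac)
  moreover have "sin k = 0" by (simp add: k_def mult.commute)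
  moreover from this have "F 1 - F 0 = (cos (k * min u 0) - 1 - cos (k * min u 1)) / k"
    by (simp add: F_def diff_divide_distrib add_divide_distrib)
  ultimately show ?thesis
    by simp
qed

subsection \<open>Entropy of the smoothed arcsine density\<close>

text \<open>The product vanishes at f x = 0 because of its first factor, whatever value the
  logarithm has there, and y ln y tends to 0 as y decreases to 0.\<close>

lemma continuous_on_mult_log:
  assumes "b > 0" "continuous_on S f" "\<And>x. x \<in> S \<Longrightarrow> f x \<ge> 0"
  shows "continuous_on S (\<lambda>x. f x * log b (f x))"
proof -
  have "((\<lambda>y. y * log b y) \<longlongrightarrow> 0) (at 0 within {0::real..})"
  proof -
    have "((\<lambda>y. y * ln y) \<longlongrightarrow> 0) (at_right (0::real))"
      by real_asymp
    then have "((\<lambda>y. y * ln y * inverse (ln b)) \<longlongrightarrow> 0 * inverse (ln b)) (at_right (0::real))"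
      by (intro tendsto_mult tendsto_const)
    moreover have "at 0 within {0::real..} = at_right 0"
      by (metis at_within_Ici_at_right)
    ultimately show ?thesis
      by (simp add: log_def divide_inverse mult.assoc)
  qed
  then have "continuous_on {0..} (\<lambda>y::real. y * log b y)"
    unfolding continuous_on_def
  proof safe
    fix x :: real assume x: "0 \<le> x"
      and lim0: "((\<lambda>y. y * log b y) \<longlongrightarrow> 0) (at 0 within {0::real..})"
    show "((\<lambda>y. y * log b y) \<longlongrightarrow> x * log b x) (at x within {0..})"
    proof (cases "x = 0")
      case True
      then show ?thesis using lim0 by simp
    next
      case False
      then show ?thesis using x unfolding log_def
        by (cases "ln b = 0") (auto intro!: tendsto_intros)
    qed
  qed
  then show ?thesis
    by (rule continuous_on_compose2[OF _ assms(2)]) (use assms(3) in auto)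
qed

text \<open>Bridge between the Lebesgue integrals in the entropies and the gauge integrals for which
  shifting, splitting and dependence on a parameter are treated.\<close>

lemma integral_lborel_compact_support:
  fixes f :: "'a::euclidean_space \<Rightarrow> real"
  assumes "compact S" "continuous_on S f" "\<And>x. x \<notin> S \<Longrightarrow> f x = 0"
  shows "integrable lborel f" "integral\<^sup>L lborel f = integral S f"
proof -
  have eq: "(\<lambda>x. indicator S x *\<^sub>R f x) = f"
    using assms(3) by (auto simp: indicator_def fun_eq_iff)
  have int: "set_integrable lborel S f"
    unfolding set_integrable_def by (rule borel_integrable_compact[OF assms(1,2)])
  then show "integrable lborel f"
    by (simp add: set_integrable_def eq[simplified])
  show "integral\<^sup>L lborel f = integral S f"
    using set_borel_integral_eq_integral(2)[OF int]
    by (simp add: set_lebesgue_integral_def eq[simplified])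
qed

lemma arcsine_window_nonneg: "a \<ge> 0 \<Longrightarrow> 0 \<le> arcsine_window a x"
  by (simp add: arcsine_window_def arcsine_cdf_mono)

lemma arcsine_window_le_1: "arcsine_window a x \<le> 1"
  using arcsine_cdf_le_1[of "x + a / 2"] arcsine_cdf_nonneg[of "x - a / 2"]
  by (simp add: arcsine_window_def)

lemma continuous_on_arcsine_window [continuous_intros]:
  assumes "continuous_on S f" "continuous_on S g"
  shows "continuous_on S (\<lambda>x. arcsine_window (f x) (g x))"
  unfolding arcsine_window_def by (intro continuous_intros assms) auto

text \<open>The free bound L lets a single interval contain the supports for a whole range of
  a.\<close>

lemma arcsine_window_eq_0:
  assumes "a \<ge> 0" "L \<ge> sqrt 2 + a / 2" "x \<notin> {-L..L}"
  shows "arcsine_window a x = 0"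
proof -
  consider "x < - L" | "x > L" using assms(3) by fastforce
  then show ?thesis
  proof cases
    case 1
    then show ?thesis using assms by (simp add: arcsine_window_def arcsine_cdf_eq_0)
  next
    case 2
    then show ?thesis using assms by (simp add: arcsine_window_def arcsine_cdf_eq_1)
  qed
qed

lemma integrable_arcsine_window:
  assumes "a \<ge> 0"
  shows "integrable lborel (arcsine_window a)"
  by (rule integral_lborel_compact_support[where S = "{- (sqrt 2 + a / 2)..sqrt 2 + a / 2}"])
     (auto intro!: continuous_intros arcsine_window_eq_0[OF assms order_refl])

text \<open>The window is a difference of two shifts of the distribution function. After moving the
  shifts into the limits of integration the common range cancels, leaving a stretch of length a
  where the function is 1 and one where it is 0.\<close>

lemma integral_arcsine_window:
  assumes "a \<ge> 0"
  shows "integral\<^sup>L lborel (arcsine_window a) = a"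
proof -
  define L where "L = sqrt 2 + a / 2"
  have L: "L \<ge> 0" "L - a / 2 \<ge> sqrt 2" "- L + a / 2 \<le> - sqrt 2" "- L + a / 2 \<le> L - a / 2"
    using assms by (auto simp: L_def)
  have int: "arcsine_cdf integrable_on {p..q}" for p q
    by (intro integrable_continuous_real continuous_intros)
  have "integral\<^sup>L lborel (arcsine_window a) = integral {- L..L} (arcsine_window a)"
    by (rule integral_lborel_compact_support)
       (auto intro!: continuous_intros arcsine_window_eq_0[OF assms order_refl] simp: L_def)
  also have "\<dots> = integral {- L..L} (\<lambda>x. arcsine_cdf (x + a / 2)) - integral {- L..L} (\<lambda>x. arcsine_cdf (x + - (a / 2)))"
    unfolding arcsine_window_def
    by (subst integral_diff[symmetric]) (auto intro!: integrable_continuous_real continuous_intros)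
  also have "integral {- L..L} (\<lambda>x. arcsine_cdf (x + a / 2)) = integral {- L + a / 2..L + a / 2} arcsine_cdf"
    using integral_shift_real_ivl[of "- L + a / 2" "a / 2" "L + a / 2" arcsine_cdf] by simp
  also have "integral {- L..L} (\<lambda>x. arcsine_cdf (x + - (a / 2))) = integral {- L - a / 2..L - a / 2} arcsine_cdf"
    using integral_shift_real_ivl[of "- L - a / 2" "- (a / 2)" "L - a / 2" arcsine_cdf] by simp
  also have "integral {- L + a / 2..L + a / 2} arcsine_cdf =
      integral {- L + a / 2..L - a / 2} arcsine_cdf + integral {L - a / 2..L + a / 2} arcsine_cdf"
    using L assms by (intro Henstock_Kurzweil_Integration.integral_combine[symmetric] int) auto
  also have "integral {L - a / 2..L + a / 2} arcsine_cdf = integral {L - a / 2..L + a / 2} (\<lambda>_. 1)"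
    using L by (intro integral_cong arcsine_cdf_eq_1) auto
  also have "\<dots> = a" using assms by simp
  also have "integral {- L - a / 2..L - a / 2} arcsine_cdf =
      integral {- L - a / 2..- L + a / 2} arcsine_cdf + integral {- L + a / 2..L - a / 2} arcsine_cdf"
    using L assms by (intro Henstock_Kurzweil_Integration.integral_combine[symmetric] int) auto
  also have "integral {- L - a / 2..- L + a / 2} arcsine_cdf = integral {- L - a / 2..- L + a / 2} (\<lambda>_. 0)"
    using L by (intro integral_cong arcsine_cdf_eq_0) auto
  finally show ?thesis by simp
qed

text \<open>Meeting point of the two halves of the argument: the differential entropy minus log a
  and the conditional entropy are each shown equal to it.\<close>

definition quantized_entropy :: "real \<Rightarrow> real" where
  "quantized_entropy a = - (\<integral>x. arcsine_window a x * log 2 (arcsine_window a x) \<partial>lborel) / a"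

lemma
  assumes "a \<ge> 0" "L \<ge> sqrt 2 + a / 2"
  shows integrable_window_log: "integrable lborel (\<lambda>x. arcsine_window a x * log 2 (arcsine_window a x))"
    and integral_window_log: "(\<integral>x. arcsine_window a x * log 2 (arcsine_window a x) \<partial>lborel) =
      integral {-L..L} (\<lambda>x. arcsine_window a x * log 2 (arcsine_window a x))"
  using assms
  by (intro integral_lborel_compact_support[where S = "{-L..L}"] continuous_on_mult_log continuous_intros
       arcsine_window_nonneg; simp add: arcsine_window_eq_0)+

text \<open>The logarithm of the quotient w/a splits where w > 0, and both sides are 0 where w = 0.
  Since w has total mass a, the part with log a integrates to exactly log a.\<close>

lemma diff_entropy_conv_arcsine_unif:
  assumes "a > 0"
  shows "diff_entropy (conv arcsine_dens (unif_dens a)) - log 2 a = quantized_entropy a"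
proof -
  let ?w = "arcsine_window a"
  have "?w x / a * log 2 (?w x / a) = ?w x * log 2 (?w x) / a - ?w x * (log 2 a / a)" for x
    using arcsine_window_nonneg[of a x] assms
    by (cases "?w x = 0") (auto simp: log_divide field_simps)
  then have "diff_entropy (conv arcsine_dens (unif_dens a)) =
      - (\<integral>x. ?w x * log 2 (?w x) / a - ?w x * (log 2 a / a) \<partial>lborel)"
    by (simp add: diff_entropy_def conv_arcsine_unif assms)
  also have "\<dots> = - ((\<integral>x. ?w x * log 2 (?w x) \<partial>lborel) / a - a * (log 2 a / a))"
    using integrable_window_log[of a "sqrt 2 + a / 2"] integrable_arcsine_window[of a]
      integral_arcsine_window[of a] assms
    by (subst Bochner_Integration.integral_diff) auto
  finally show ?thesis
    using assms by (simp add: quantized_entropy_def)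
qed

lemma quantized_entropy_nonneg:
  assumes "a > 0"
  shows "quantized_entropy a \<ge> 0"
proof -
  have "0 \<le> - (arcsine_window a x * log 2 (arcsine_window a x))" for x
  proof (cases "arcsine_window a x = 0")
    case False
    then have "0 < arcsine_window a x" using arcsine_window_nonneg[of a x] assms by simp
    then have "log 2 (arcsine_window a x) \<le> 0" by (simp add: arcsine_window_le_1)
    then show ?thesis using \<open>0 < arcsine_window a x\<close> by (simp add: mult_nonneg_nonpos)
  qed simp
  then have "0 \<le> (\<integral>x. - (arcsine_window a x * log 2 (arcsine_window a x)) \<partial>lborel)"
    by (intro Bochner_Integration.integral_nonneg)
  then show ?thesis
    using assms by (simp add: quantized_entropy_def divide_le_0_iff)
qed

text \<open>Follows from ln z <= z - 1 at z = 1/y. The constant is not sharp; any bound uniform in y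
  gives the domination.\<close>

lemma minus_mult_log2_le: "- (y * log 2 y) \<le> 1 / ln 2" if "y \<ge> 0" for y :: real
proof (cases "y = 0")
  case False
  then have y: "y > 0" using that by simp
  have "ln (1 / y) \<le> 1 / y - 1" using y by (intro ln_le_minus_one) auto
  then have "- (y * ln y) \<le> 1 - y" using y by (simp add: ln_div field_simps)
  then have "- (y * ln y) / ln 2 \<le> 1 / ln 2" using y by (intro divide_right_mono) auto
  then show ?thesis by (simp add: log_def)
qed simp

text \<open>The pointwise bound is applied to the density w/a rather than to w, so its contribution
  stays bounded as a tends to 0 and the only singular term is - log a, which is integrable at
  0.\<close>

lemma quantized_entropy_le:
  assumes "a > 0" "L \<ge> sqrt 2 + a / 2"
  shows "quantized_entropy a \<le> 2 * L / ln 2 - log 2 a"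
proof -
  let ?g = "\<lambda>x. arcsine_window a x / a"
  have L: "L \<ge> 0" using assms by (smt (verit) real_sqrt_ge_zero divide_nonneg_nonneg)
  have cont: "continuous_on {-L..L} (\<lambda>x. ?g x * log 2 (?g x))"
    using assms by (intro continuous_on_mult_log continuous_intros) (auto simp: arcsine_window_nonneg)
  have "diff_entropy (conv arcsine_dens (unif_dens a)) = - (\<integral>x. ?g x * log 2 (?g x) \<partial>lborel)"
    by (simp add: diff_entropy_def conv_arcsine_unif assms)
  also have "\<dots> = integral {-L..L} (\<lambda>x. - (?g x * log 2 (?g x)))"
    using assms cont
    by (subst integral_lborel_compact_support[where S = "{-L..L}"]) (auto simp: arcsine_window_eq_0)
  also have "\<dots> \<le> integral {-L..L} (\<lambda>x. 1 / ln 2)"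
    using assms cont
    by (intro integral_le integrable_continuous_real continuous_on_minus minus_mult_log2_le)
       (auto simp: arcsine_window_nonneg)
  also have "\<dots> = 2 * L / ln 2" using L by simp
  finally show ?thesis
    using diff_entropy_conv_arcsine_unif[OF assms(1)] by simp
qed

lemma continuous_on_quantized_entropy:
  "continuous_on {0<..c} quantized_entropy"
proof -
  \<comment> \<open>An interval wide enough for the largest parameter c serves all a in (0, c], so a
    enters the integral only through its jointly continuous integrand.\<close>
  define L where "L = sqrt 2 + c / 2"
  let ?I = "\<lambda>a. integral (cbox (-L) L) (\<lambda>x. arcsine_window a x * log 2 (arcsine_window a x))"
  have "continuous_on {0<..c} (\<lambda>a. - ?I a / a)"
  proof (intro continuous_intros integral_continuous_on_param)
    show "continuous_on ({0<..c} \<times> cbox (- L) L) (\<lambda>(a, x). arcsine_window a x * log 2 (arcsine_window a x))"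
      unfolding case_prod_unfold
      by (intro continuous_on_mult_log continuous_intros) (auto intro: arcsine_window_nonneg)
  qed auto
  then show ?thesis
  proof (rule continuous_on_eq)
    show "- ?I a / a = quantized_entropy a" if "a \<in> {0<..c}" for a
      using that integral_window_log[of a L] by (simp add: quantized_entropy_def L_def)
  qed
qed

subsection \<open>Riemann sums\<close>

text \<open>The step functions below sample at the right endpoint \<open>\<lceil>n x\<rceil> / n \<ge> x\<close>, so an antimonotone
  bound on \<open>f\<close> also dominates them, even if it is singular at \<open>0\<close>.\<close>

lemma right_riemann_sums_tendsto:
  fixes f h :: "real \<Rightarrow> real"
  assumes cont: "continuous_on {0<..1} f" and h: "h integrable_on {0..1}"
    and anti: "\<And>x y. 0 < x \<Longrightarrow> x \<le> y \<Longrightarrow> y \<le> 1 \<Longrightarrow> h y \<le> h x"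
    and bound: "\<And>x. 0 < x \<Longrightarrow> x \<le> 1 \<Longrightarrow> \<bar>f x\<bar> \<le> h x"
  shows "f integrable_on {0..1}"
    and "(\<lambda>n. (\<Sum>l = 1..n. f (real l / real n)) / real n) \<longlonglongrightarrow> integral {0..1} f"
proof -
  \<comment> \<open>\<open>Suc n\<close> cells avoid division by zero; the index shift is undone at
    the end by \<open>LIMSEQ_imp_Suc\<close>.\<close>
  define r where "r n x = real_of_int \<lceil>real (Suc n) * x\<rceil> / real (Suc n)" for n x
  have r: "x \<le> r n x" "r n x \<le> 1" "r n x \<le> x + 1 / real (Suc n)" if "0 < x" "x < 1" for n x
  proof -
    have "\<lceil>real (Suc n) * x\<rceil> \<le> int (Suc n)"
      using that by (subst ceiling_le_iff) auto
    then have "real_of_int \<lceil>real (Suc n) * x\<rceil> \<le> real (Suc n)"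
      by linarith
    then show "r n x \<le> 1" unfolding r_def by (simp add: field_simps)
    show "x \<le> r n x" "r n x \<le> x + 1 / real (Suc n)"
      unfolding r_def using le_of_int_ceiling[of "real (Suc n) * x"] of_int_ceiling_le_add_one[of "real (Suc n) * x"]
      by (simp_all add: field_simps del: of_nat_Suc)
  qed
  \<comment> \<open>Induction on the number m of cells already integrated.\<close>
  have step: "((\<lambda>x. f (r n x)) has_integral (\<Sum>l = 1..m. f (real l / real (Suc n))) / real (Suc n)) {0..real m / real (Suc n)}" for n m
  proof (induction m)
    case 0
    show ?case by (simp add: has_integral_refl)
  next
    case (Suc m)
    let ?p = "real m / real (Suc n)" and ?q = "real (Suc m) / real (Suc n)"
    have "((\<lambda>x. f (r n x)) has_integral f ?q * (?q - ?p)) {?p..?q}"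
    \<comment> \<open>At the left end of the cell the ceiling is still m, so this one point is
      excepted.\<close>
    proof (rule has_integral_spike_finite[where S = "{?p}" and f = "\<lambda>_. f ?q"])
      fix x assume "x \<in> {?p..?q} - {?p}"
      then have "real m < real (Suc n) * x" "real (Suc n) * x \<le> real (Suc m)"
        by (auto simp: field_simps)
      then have "\<lceil>real (Suc n) * x\<rceil> = int (Suc m)"
        by (intro ceiling_unique) auto
      then show "f (r n x) = f ?q" by (simp add: r_def)
    next
      show "((\<lambda>_. f ?q) has_integral f ?q * (?q - ?p)) {?p..?q}"
        using has_integral_const_real[of "f ?q" ?p ?q] by (simp add: field_simps)
    qed simp
    then have "((\<lambda>x. f (r n x)) has_integral (\<Sum>l = 1..m. f (real l / real (Suc n))) / real (Suc n) + f ?q * (?q - ?p)) {0..?q}"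
      by (intro has_integral_combine[OF _ _ Suc.IH]) (auto simp: divide_right_mono)
    moreover have "?q - ?p = 1 / real (Suc n)"
      by (simp add: diff_divide_distrib[symmetric])
    ultimately show ?case
      by (simp add: add_divide_distrib add.commute)
  qed
  \<comment> \<open>On the open interval every sample point lies in (0, 1]; nothing is assumed about
    f or its bound at 0.\<close>
  have step1: "((\<lambda>x. f (r n x)) has_integral (\<Sum>l = 1..Suc n. f (real l / real (Suc n))) / real (Suc n)) {0<..<1}" for n
    using step[of n "Suc n"] by (subst has_integral_Icc_iff_Ioo[symmetric]) simp
  have dom: "norm (f (r n x)) \<le> h x" if "x \<in> {0<..<1}" for n x
    using bound[of "r n x"] anti[of x "r n x"] r[of x n] that by (auto intro: order_trans)
  have lim: "(\<lambda>n. f (r n x)) \<longlonglongrightarrow> f x" if x: "x \<in> {0<..<1}" for x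
  proof (rule continuous_on_tendsto_compose[OF cont])
    show "(\<lambda>n. r n x) \<longlonglongrightarrow> x"
    proof (rule tendsto_sandwich[of "\<lambda>_. x" _ _ "\<lambda>n. x + 1 / real (Suc n)"])
      show "(\<lambda>n. x + 1 / real (Suc n)) \<longlonglongrightarrow> x"
        using tendsto_add[OF tendsto_const LIMSEQ_Suc[OF lim_1_over_n], of x] by simp
    qed (use x r in auto)
    show "\<forall>\<^sub>F n in sequentially. r n x \<in> {0<..1}"
      using x r[of x] by (auto intro!: always_eventually intro: less_le_trans)
  qed (use x in auto)
  note dc = dominated_convergence[OF has_integral_integrable[OF step1] h[unfolded integrable_on_Icc_iff_Ioo] dom lim]
  show "f integrable_on {0..1}"
    unfolding integrable_on_Icc_iff_Ioo by (rule dc(1))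
  have "(\<lambda>n. integral {0<..<1} (\<lambda>x. f (r n x))) \<longlonglongrightarrow> integral {0<..<1} f"
    by (rule dc(2))
  then have "(\<lambda>n. (\<Sum>l = 1..Suc n. f (real l / real (Suc n))) / real (Suc n)) \<longlonglongrightarrow> integral {0..1} f"
    unfolding integral_unique[OF step1] integral_open_interval_real .
  then show "(\<lambda>n. (\<Sum>l = 1..n. f (real l / real n)) / real n) \<longlonglongrightarrow> integral {0..1} f"
    by (rule LIMSEQ_imp_Suc)
qed

text \<open>Source of the factor e in the limit: the antiderivative contributes -1/ln 2 = - log e at
  x = 1. At x = 0 it is continuous with value 0.\<close>

lemma has_integral_log2:
  assumes "c > 0"
  shows "((\<lambda>x. log 2 (c * x)) has_integral log 2 (c / exp 1)) {0..1}"
proof -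
  define F where "F x = x * log 2 x + x * (log 2 c - 1 / ln 2)" for x
  have "((\<lambda>x. log 2 (c * x)) has_integral F 1 - F 0) {0..1}"
  proof (rule fundamental_theorem_of_calculus_interior)
    show "continuous_on {0..1} F"
      unfolding F_def by (intro continuous_intros continuous_on_mult_log) auto
    fix x :: real assume x: "x \<in> {0<..<1}"
    have "(F has_real_derivative log 2 (c * x)) (at x)"
      unfolding F_def log_def using x assms
      by (auto intro!: derivative_eq_intros simp: ln_mult field_simps)
    then show "(F has_vector_derivative log 2 (c * x)) (at x)"
      by (simp add: has_real_derivative_iff_has_vector_derivative)
  qed simp
  moreover have "F 1 - F 0 = log 2 (c / exp 1)"
    using assms by (simp add: F_def log_def ln_div diff_divide_distrib)
  ultimately show ?thesis by simp
qed

lemma riemann_sums_quantized_entropy: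
  assumes "c > 0"
  shows "(\<lambda>n. (\<Sum>l = 1..n. quantized_entropy (c * (real l / real n))) / real n) \<longlonglongrightarrow>
    integral {0..1} (\<lambda>x. diff_entropy (conv arcsine_dens (unif_dens (c * x)))) - log 2 (c / exp 1)"
proof -
  define L where "L = sqrt 2 + c / 2"
  define f where "f = (\<lambda>x. quantized_entropy (c * x))"
  \<comment> \<open>The bound of \<open>quantized_entropy_le\<close>, with L chosen for the largest
    argument c.\<close>
  define h where "h x = 2 * L / ln 2 - log 2 (c * x)" for x
  have log: "(\<lambda>x. log 2 (c * x)) integrable_on {0..1}"
    using has_integral_log2[OF assms] by (rule has_integral_integrable)
  have cont: "continuous_on {0<..1} f"
    unfolding f_def
    by (rule continuous_on_compose2[OF continuous_on_quantized_entropy[of c]])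
       (use assms in \<open>auto intro!: continuous_intros\<close>)
  have h: "h integrable_on {0..1}"
    unfolding h_def by (intro integrable_diff log) auto
  have anti: "h y \<le> h x" if "0 < x" "x \<le> y" for x y
    using that assms by (simp add: h_def)
  have bound: "\<bar>f x\<bar> \<le> h x" if "0 < x" "x \<le> 1" for x
    using that assms quantized_entropy_nonneg[of "c * x"] quantized_entropy_le[of "c * x" L]
    by (auto simp: f_def h_def L_def)
  note R = right_riemann_sums_tendsto[OF cont h anti bound]
  have "integral {0..1} (\<lambda>x. diff_entropy (conv arcsine_dens (unif_dens (c * x)))) =
      integral {0..1} (\<lambda>x. f x + log 2 (c * x))"
  proof (rule integral_spike[where S = "{0}"])
    fix x :: real assume "x \<in> {0..1} - {0}"
    then show "f x + log 2 (c * x) = diff_entropy (conv arcsine_dens (unif_dens (c * x)))"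
      using diff_entropy_conv_arcsine_unif[of "c * x"] assms by (simp add: f_def)
  qed auto
  also have "\<dots> = integral {0..1} f + log 2 (c / exp 1)"
    using integral_add[OF R(1) log] integral_unique[OF has_integral_log2[OF assms]] by simp
  finally show ?thesis
    using R(2) by (simp add: f_def)
qed

subsection \<open>Law of the dithered quantizer\<close>

text \<open>Unit length makes the normalizing factor 1. Dropping the right endpoint, a null set,
  gives an interval whose integer translates tile the line.\<close>

lemma uniform_measure_lborel_unit_interval:
  fixes a b :: real
  assumes "b = a + 1"
  shows "uniform_measure lborel {a..b} = density lborel (indicator {a..<b})"
  unfolding uniform_measure_def
proof (rule density_cong)
  show "AE x in lborel. indicator {a..b} x / emeasure lborel {a..b} = (indicator {a..<b} x :: ennreal)"
    using AE_lborel_singleton[of b] by eventually_elim (auto simp: assms indicator_def)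
qed auto

text \<open>Reason why the law of cos(pi l U) does not depend on l. Rescaling by l turns [0, 1) into
  l unit cells. On even cells the cosine repeats by periodicity, on odd cells it is reflected by u
  -> 1 - u, so all cells contribute equally and the factor l cancels.\<close>

lemma nn_integral_cos_multiple:
  assumes [measurable]: "g \<in> borel_measurable borel" and "l > 0"
  shows "(\<integral>\<^sup>+u. g (cos (pi * real l * u)) * indicator {0..<1} u \<partial>lborel) =
    (\<integral>\<^sup>+u. g (cos (pi * u)) * indicator {0..<1} u \<partial>lborel)"
    (is "?X = ?Y")
proof -
  define I where "I j = (\<integral>\<^sup>+u. g (cos (pi * u)) * indicator {0..<real j} u \<partial>lborel)" for j
  have piece: "(\<integral>\<^sup>+u. g (cos (pi * u)) * indicator {real j..<real (Suc j)} u \<partial>lborel) = ?Y" for j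
  proof -
    have "(\<integral>\<^sup>+u. g (cos (pi * u)) * indicator {real j..<real (Suc j)} u \<partial>lborel) =
        (\<integral>\<^sup>+u. g (cos (pi * (real j + u))) * indicator {0..<1} u \<partial>lborel)"
      by (subst nn_integral_real_affine[where c = 1 and t = "real j"])
         (auto intro!: nn_integral_cong simp: indicator_def)
    also have "\<dots> = ?Y"
    proof (cases "even j")
      case True
      then have "cos (pi * (real j + u)) = cos (pi * u)" for u
        by (simp add: distrib_left cos_add mult.commute[of pi "real j"])
      then show ?thesis by simp
    next
      case False
      then have *: "cos (pi * (real j + u)) = cos (pi * (1 + -1 * u))" for u
        by (simp add: distrib_left cos_add cos_diff right_diff_distrib mult.commute[of pi "real j"])
      have "(\<integral>\<^sup>+u. g (cos (pi * (real j + u))) * indicator {0..<1} u \<partial>lborel) =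
          (\<integral>\<^sup>+u. g (cos (pi * (1 + -1 * u))) * indicator {0<..1} (1 + -1 * u) \<partial>lborel)"
        unfolding * by (intro nn_integral_cong) (auto simp: indicator_def)
      also have "\<dots> = (\<integral>\<^sup>+u. g (cos (pi * u)) * indicator {0<..1} u \<partial>lborel)"
        by (subst nn_integral_real_affine[where c = "-1" and t = 1]) auto
      \<comment> \<open>The reflection has moved the open end of the interval; the endpoints are
        null.\<close>
      also have "\<dots> = ?Y"
      proof (rule nn_integral_cong_AE)
        show "AE u in lborel. g (cos (pi * u)) * indicator {0<..1} u = g (cos (pi * u)) * indicator {0..<1} u"
          using AE_lborel_singleton[of 0] AE_lborel_singleton[of 1]
          by eventually_elim (auto simp: indicator_def)
      qed
      finally show ?thesis .
    qed
    finally show ?thesis .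
  qed
  have I: "I j = of_nat j * ?Y" for j
  proof (induction j)
    case (Suc j)
    have "I (Suc j) = I j + (\<integral>\<^sup>+u. g (cos (pi * u)) * indicator {real j..<real (Suc j)} u \<partial>lborel)"
      unfolding I_def
      by (subst nn_integral_add[symmetric]) (auto intro!: nn_integral_cong simp: indicator_def)
    then show ?case
      unfolding piece Suc.IH by (simp add: distrib_right add.commute)
  qed (simp add: I_def)
  have "I l = ennreal \<bar>real l\<bar> * ?X"
    unfolding I_def using assms(2)
    by (subst nn_integral_real_affine[where c = "real l" and t = 0])
       (auto intro!: arg_cong[where f = "\<lambda>x. _ * x"] nn_integral_cong
         simp: indicator_def mult.assoc zero_le_mult_iff)
  with I[of l] have "of_nat l * ?X = of_nat l * ?Y"
    by (simp add: ennreal_of_nat_eq_real_of_nat)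
  then show ?thesis
    using assms(2) by (subst (asm) ennreal_mult_cancel_left) (auto simp: ennreal_of_nat_eq_real_of_nat)
qed

text \<open>The map u -> - sqrt 2 cos(pi u) is the quantile function of the arcsine law: with t = pi
  u - pi/2 it is sqrt 2 sin t, and \<open>arcsin\<close> recovers t.\<close>

lemma minus_cos_less_iff_arcsine_cdf:
  assumes "0 \<le> u" "u < 1"
  shows "- (sqrt 2 * cos (pi * u)) < x \<longleftrightarrow> u < arcsine_cdf x"
proof -
  define y where "y = max (-1) (min 1 (x / sqrt 2))"
  define t where "t = pi * u - pi / 2"
  have sin: "sin t = - cos (pi * u)"
    by (simp add: t_def sin_diff)
  have t: "- (pi / 2) \<le> t" "t < pi / 2"
    using assms by (auto simp: t_def)
  then have "sin t < sin (pi / 2)"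
    by (intro sin_monotone_2pi) auto
  then have "sin t < 1" by simp
  have "- (sqrt 2 * cos (pi * u)) < x \<longleftrightarrow> sin t < x / sqrt 2"
    by (simp add: sin field_simps)
  also have "\<dots> \<longleftrightarrow> sin t < y"
    \<comment> \<open>Clamping the threshold does not change the comparison because -1 <= sin t < 1;
      the strict bound comes from u < 1.\<close>
    using \<open>sin t < 1\<close> sin_ge_minus_one[of t] unfolding y_def by linarith
  also have "\<dots> \<longleftrightarrow> arcsin (sin t) < arcsin y"
    by (subst arcsin_less_mono) (auto simp: y_def abs_le_iff)
  also have "arcsin (sin t) = t"
    using t by (intro arcsin_sin) auto
  also have "t < arcsin y \<longleftrightarrow> u < arcsine_cdf x"
    by (simp add: arcsine_cdf_def flip: y_def) (simp add: t_def field_simps)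
  finally show ?thesis .
qed

text \<open>After reduction to l = 1, the quantile equivalence at p and at q turns the event into an
  interval of u, half-open at the same end.\<close>

lemma nn_integral_cos_interval:
  assumes "p \<le> q" "l > 0"
  shows "(\<integral>\<^sup>+u. indicator {p..<q} (- (sqrt 2 * cos (pi * real l * u))) * indicator {0..<1} u \<partial>lborel) =
    ennreal (arcsine_cdf q - arcsine_cdf p)"
proof -
  have "(\<integral>\<^sup>+u. indicator {p..<q} (- (sqrt 2 * cos (pi * real l * u))) * indicator {0..<1} u \<partial>lborel) =
      (\<integral>\<^sup>+u. indicator {p..<q} (- (sqrt 2 * cos (pi * u))) * indicator {0..<1} u \<partial>lborel)"
    using assms by (intro nn_integral_cos_multiple[where g = "\<lambda>y. indicator {p..<q} (- (sqrt 2 * y))"]) auto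
  also have "\<dots> = (\<integral>\<^sup>+u. indicator {arcsine_cdf p..<arcsine_cdf q} u \<partial>lborel)"
  proof (intro nn_integral_cong)
    fix u :: real
    show "indicator {p..<q} (- (sqrt 2 * cos (pi * u))) * indicator {0..<1} u =
      (indicator {arcsine_cdf p..<arcsine_cdf q} u :: ennreal)"
    proof (cases "u \<in> {0..<1}")
      case True
      then show ?thesis
        using minus_cos_less_iff_arcsine_cdf[of u p] minus_cos_less_iff_arcsine_cdf[of u q]
        by (auto simp: indicator_def)
    next
      case False
      then show ?thesis
        using arcsine_cdf_nonneg[of p] arcsine_cdf_le_1[of q] by (auto simp: indicator_def)
    qed
  qed
  also have "\<dots> = ennreal (arcsine_cdf q - arcsine_cdf p)"
    using arcsine_cdf_mono[OF assms(1)] by simp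
  finally show ?thesis .
qed

text \<open>For each real t exactly one integer n, namely the ceiling of t - 1/2, has n - t in
  [-1/2, 1/2). Substituting v = n - t and exchanging sum and integral therefore counts every t
  once.\<close>

lemma distr_int_minus_unit_interval:
  "distr (density (count_space (UNIV :: int set) \<Otimes>\<^sub>M lborel) (\<lambda>(n, v). indicator {-1/2..<1/2} v))
     lborel (\<lambda>(n, v). real_of_int n - v) = lborel"
    (is "distr ?D _ ?s = _")
proof -
  interpret pair_sigma_finite "count_space (UNIV :: int set)" "lborel :: real measure"
    by (intro pair_sigma_finite.intro sigma_finite_lborel sigma_finite_measure_count_space)
  show ?thesis
  proof (rule measure_eqI)
    fix A assume "A \<in> sets (distr ?D lborel ?s)"
    then have [measurable]: "A \<in> sets borel" by simp
    have "emeasure (distr ?D lborel ?s) A = (\<integral>\<^sup>+x. indicator A x \<partial>distr ?D lborel ?s)"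
      by simp
    also have "\<dots> = (\<integral>\<^sup>+z. indicator A (?s z) \<partial>?D)"
      by (rule nn_integral_distr) auto
    also have "\<dots> = (\<integral>\<^sup>+(n, v). indicator {-1/2..<1/2} v * indicator A (real_of_int n - v) \<partial>(count_space UNIV \<Otimes>\<^sub>M lborel))"
      by (subst nn_integral_density) (auto simp: case_prod_unfold)
    also have "\<dots> = (\<integral>\<^sup>+n. \<integral>\<^sup>+v. indicator {-1/2..<1/2} v * indicator A (real_of_int n - v) \<partial>lborel \<partial>count_space UNIV)"
      by (subst lborel.nn_integral_fst[symmetric]) auto
    also have "\<dots> = (\<integral>\<^sup>+n. \<integral>\<^sup>+t. indicator {-1/2..<1/2} (real_of_int n - t) * indicator A t \<partial>lborel \<partial>count_space UNIV)"
    proof (rule nn_integral_cong)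
      fix n :: int
      show "(\<integral>\<^sup>+v. indicator {-1/2..<1/2} v * indicator A (real_of_int n - v) \<partial>lborel) =
          (\<integral>\<^sup>+t. indicator {-1/2..<1/2} (real_of_int n - t) * indicator A t \<partial>lborel)"
        by (subst nn_integral_real_affine[where c = "-1" and t = "real_of_int n"]) auto
    qed
    also have "\<dots> = (\<integral>\<^sup>+t. \<integral>\<^sup>+n. indicator {-1/2..<1/2} (real_of_int n - t) * indicator A t \<partial>count_space UNIV \<partial>lborel)"
      by (rule Fubini'[symmetric]) auto
    also have "\<dots> = (\<integral>\<^sup>+t. indicator A t \<partial>lborel)"
    proof (intro nn_integral_cong)
      fix t :: real
      have "indicator {-1/2..<1/2} (real_of_int n - t) = (indicator {\<lceil>t - 1 / 2\<rceil>} n :: ennreal)" for n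
      proof -
        have "- 1 / 2 \<le> real_of_int n - t \<and> real_of_int n - t < 1 / 2 \<longleftrightarrow> n = \<lceil>t - 1 / 2\<rceil>"
          by linarith
        then show ?thesis by (auto simp: indicator_def)
      qed
      then show "(\<integral>\<^sup>+n. indicator {-1/2..<1/2} (real_of_int n - t) * indicator A t \<partial>count_space UNIV) = indicator A t"
        by (simp add: nn_integral_multc)
    qed
    finally show "emeasure (distr ?D lborel ?s) A = emeasure lborel A" by simp
  qed simp
qed

lemma Ycoef_unit_interval:
  assumes "l > 0" "0 \<le> u" "u < 1"
  shows "Ycoef l u = - (sqrt 2 * cos (pi * real l * u)) / (pi * real l)"
  using assms by (simp add: Ycoef_eq)

lemma borel_measurable_Ycoef [measurable]: "l > 0 \<Longrightarrow> Ycoef l \<in> borel_measurable borel"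
proof -
  assume "l > 0"
  then have "Ycoef l = (\<lambda>u. sqrt 2 / (pi * real l) * (cos (pi * real l * min u 0) - 1 - cos (pi * real l * min u 1)))"
    by (intro ext Ycoef_eq)
  then show ?thesis by simp
qed

lemma measurable_round [measurable]: "(round :: real \<Rightarrow> int) \<in> borel \<rightarrow>\<^sub>M count_space UNIV"
  unfolding round_def by measurable

text \<open>Rounding sends ties upwards, so the output is n on a half-open interval of Y/d of length
  1. Multiplication by a = pi l d makes it the window of width a around a (n - v) for the arcsine
  variable.\<close>

lemma nn_integral_round_Ycoef:
  assumes "l > 0" "d > 0"
  shows "(\<integral>\<^sup>+u. indicator {n} (round (Ycoef l u / d + v)) \<partial>uniform_measure lborel {0..1}) =
    ennreal (arcsine_window (pi * real l * d) (pi * real l * d * (real_of_int n - v)))"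
proof -
  define a where "a = pi * real l * d"
  have a: "a > 0" using assms by (simp add: a_def)
  let ?x = "a * (real_of_int n - v)"
  have [measurable]: "Ycoef l \<in> borel_measurable borel" using assms by measurable
  have "(\<lambda>u. round (Ycoef l u / d + v)) \<in> borel \<rightarrow>\<^sub>M count_space UNIV"
    by measurable
  then have meas: "(\<lambda>u. indicator {n} (round (Ycoef l u / d + v)) :: ennreal) \<in> borel_measurable borel"
    by (rule measurable_compose) simp
  have "(\<integral>\<^sup>+u. indicator {n} (round (Ycoef l u / d + v)) \<partial>uniform_measure lborel {0..1}) =
      (\<integral>\<^sup>+u. indicator {0..<1} u * indicator {n} (round (Ycoef l u / d + v)) \<partial>lborel)"
    using meas by (subst uniform_measure_lborel_unit_interval, simp, subst nn_integral_density) auto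
  also have "\<dots> = (\<integral>\<^sup>+u. indicator {?x - a / 2..<?x + a / 2} (- (sqrt 2 * cos (pi * real l * u))) * indicator {0..<1} u \<partial>lborel)"
  proof (intro nn_integral_cong)
    fix u :: real
    show "indicator {0..<1} u * indicator {n} (round (Ycoef l u / d + v)) =
      (indicator {?x - a / 2..<?x + a / 2} (- (sqrt 2 * cos (pi * real l * u))) * indicator {0..<1} u :: ennreal)"
    proof (cases "u \<in> {0..<1}")
      case True
      define w where "w = - (sqrt 2 * cos (pi * real l * u))"
      have "Ycoef l u / d = w / a"
        using True assms by (simp add: Ycoef_unit_interval a_def w_def)
      moreover have "round (w / a + v) = n \<longleftrightarrow> real_of_int n - v - 1 / 2 \<le> w / a \<and> w / a < real_of_int n - v + 1 / 2"
        unfolding round_def by linarith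
      moreover have "\<dots> \<longleftrightarrow> ?x - a / 2 \<le> w \<and> w < ?x + a / 2"
        using a by (simp add: field_simps)
      ultimately show ?thesis
        using True by (simp add: indicator_def flip: w_def)
    qed simp
  qed
  also have "\<dots> = ennreal (arcsine_window a ?x)"
    unfolding arcsine_window_def using a assms by (intro nn_integral_cos_interval) auto
  finally show ?thesis by (simp add: a_def)
qed

lemma prob_space_joint_UV: "prob_space joint_UV"
proof -
  interpret U: prob_space "uniform_measure lborel {0..1::real}"
    by (rule prob_space_uniform_measure) auto
  interpret V: prob_space "uniform_measure lborel {-1/2..1/2::real}"
    by (rule prob_space_uniform_measure) auto
  interpret pair_prob_space "uniform_measure lborel {0..1::real}" "uniform_measure lborel {-1/2..1/2::real}" ..
  show ?thesis unfolding joint_UV_def by (rule prob_space_axioms)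
qed

lemma distributed_snd_joint_UV:
  "distributed joint_UV lborel snd (indicator {-1/2..<1/2::real} :: real \<Rightarrow> real)"
proof -
  interpret U: prob_space "uniform_measure lborel {0..1::real}"
    by (rule prob_space_uniform_measure) auto
  interpret V: prob_space "uniform_measure lborel {-1/2..1/2::real}"
    by (rule prob_space_uniform_measure) auto
  have "distr joint_UV lborel snd = uniform_measure lborel {-1/2..1/2::real}"
  proof (rule measure_eqI)
    fix A :: "real set" assume "A \<in> sets (distr joint_UV lborel snd)"
    then have [measurable]: "A \<in> sets borel" by simp
    have "snd -` A \<inter> space joint_UV = UNIV \<times> A"
      by (auto simp: joint_UV_def space_pair_measure)
    then show "emeasure (distr joint_UV lborel snd) A = emeasure (uniform_measure lborel {-1/2..1/2}) A"
      using V.emeasure_pair_measure_Times[of UNIV "uniform_measure lborel {0..1::real}" A] U.emeasure_space_1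
      by (subst emeasure_distr) (auto simp: joint_UV_def)
  qed simp
  also have "\<dots> = density lborel (indicator {-1/2..<1/2})"
    by (rule uniform_measure_lborel_unit_interval) simp
  finally show ?thesis
    by (auto simp: distributed_def joint_UV_def ennreal_indicator)
qed

text \<open>Given the dither v, the output n has the window mass just computed; multiplying by the
  density of v gives the joint density with respect to counting times Lebesgue measure.\<close>

lemma distributed_round_Ycoef:
  assumes "l > 0" "d > 0"
  defines "a \<equiv> pi * real l * d"
  shows "distributed joint_UV (count_space UNIV \<Otimes>\<^sub>M lborel)
    (\<lambda>z. ((\<lambda>(u, v). round (Ycoef l u / d + v)) z, snd z))
    (\<lambda>(n, v). indicator {-1/2..<1/2} v * arcsine_window a (a * (real_of_int n - v)))"
    (is "distributed _ ?N ?X ?p")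
proof -
  let ?C = "count_space (UNIV :: int set)"
  let ?U = "uniform_measure lborel {0..1::real}" and ?V = "uniform_measure lborel {-1/2..1/2::real}"
  interpret U: prob_space ?U
    by (rule prob_space_uniform_measure) auto
  interpret V: prob_space ?V
    by (rule prob_space_uniform_measure) auto
  interpret UV: pair_sigma_finite ?U ?V ..
  interpret C: sigma_finite_measure ?C
    by (rule sigma_finite_measure_count_space)
  interpret CU: pair_sigma_finite ?C ?U ..
  interpret CL: pair_sigma_finite ?C "lborel :: real measure" ..
  have a: "a > 0" using assms by (simp add: a_def)
  have [measurable]: "Ycoef l \<in> borel_measurable borel" using assms by measurable
  have [measurable]: "arcsine_window a \<in> borel_measurable borel"
    by (intro borel_measurable_continuous_onI continuous_intros)
  have X [measurable]: "?X \<in> joint_UV \<rightarrow>\<^sub>M ?N"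
    unfolding joint_UV_def case_prod_unfold by measurable
  have p [measurable]: "?p \<in> borel_measurable ?N"
    by measurable
  have "distr joint_UV ?N ?X = density ?N ?p"
  proof (rule measure_eqI)
    fix B assume "B \<in> sets (distr joint_UV ?N ?X)"
    then have B [measurable]: "B \<in> sets ?N" by simp
    let ?Q = "\<lambda>u v. round (Ycoef l u / d + v)"
    have "emeasure (distr joint_UV ?N ?X) B = (\<integral>\<^sup>+y. indicator B y \<partial>distr joint_UV ?N ?X)"
      by simp
    also have "\<dots> = (\<integral>\<^sup>+(u, v). indicator B (?Q u v, v) \<partial>joint_UV)"
      by (subst nn_integral_distr[OF X]) (auto simp: case_prod_unfold)
    also have "\<dots> = (\<integral>\<^sup>+v. \<integral>\<^sup>+u. indicator B (?Q u v, v) \<partial>?U \<partial>?V)"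
    proof -
      have "(\<lambda>(u, v). indicator B (?Q u v, v) :: ennreal) \<in> borel_measurable (?U \<Otimes>\<^sub>M ?V)"
        by measurable
      from UV.nn_integral_snd[OF this] show ?thesis
        unfolding joint_UV_def by simp
    qed
    also have "\<dots> = (\<integral>\<^sup>+v. \<integral>\<^sup>+n. ennreal (arcsine_window a (a * (real_of_int n - v))) * indicator B (n, v) \<partial>?C \<partial>?V)"
    proof (rule nn_integral_cong)
      fix v :: real
      \<comment> \<open>Inserts a sum over n that selects the actual output, so that n can be moved
        outside the integral over u. Testing whether a real difference is 0 keeps the selector
        jointly measurable in n and u.\<close>
      have "(\<integral>\<^sup>+u. indicator B (?Q u v, v) \<partial>?U) =
          (\<integral>\<^sup>+u. \<integral>\<^sup>+n. indicator B (n, v) * indicator {0::real} (real_of_int (?Q u v) - real_of_int n) \<partial>?C \<partial>?U)"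
      proof (rule nn_integral_cong)
        fix u :: real
        have "(\<integral>\<^sup>+n. indicator B (n, v) * indicator {0::real} (real_of_int (?Q u v) - real_of_int n) \<partial>?C) =
            (\<integral>\<^sup>+n. indicator B (?Q u v, v) * indicator {?Q u v} n \<partial>?C)"
          by (intro nn_integral_cong) (auto simp: indicator_def)
        then show "indicator B (?Q u v, v) =
            (\<integral>\<^sup>+n. indicator B (n, v) * indicator {0::real} (real_of_int (?Q u v) - real_of_int n) \<partial>?C)"
          by (simp add: nn_integral_cmult)
      qed
      also have "\<dots> = (\<integral>\<^sup>+n. \<integral>\<^sup>+u. indicator B (n, v) * indicator {0::real} (real_of_int (?Q u v) - real_of_int n) \<partial>?U \<partial>?C)"
        by (rule CU.Fubini') measurable
      also have "\<dots> = (\<integral>\<^sup>+n. ennreal (arcsine_window a (a * (real_of_int n - v))) * indicator B (n, v) \<partial>?C)"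
      proof (rule nn_integral_cong)
        fix n :: int
        have "(\<integral>\<^sup>+u. indicator B (n, v) * indicator {0::real} (real_of_int (?Q u v) - real_of_int n) \<partial>?U) =
            indicator B (n, v) * (\<integral>\<^sup>+u. indicator {0::real} (real_of_int (?Q u v) - real_of_int n) \<partial>?U)"
          by (rule nn_integral_cmult) measurable
        also have "(\<integral>\<^sup>+u. indicator {0::real} (real_of_int (?Q u v) - real_of_int n) \<partial>?U) =
            (\<integral>\<^sup>+u. indicator {n} (?Q u v) \<partial>?U)"
          by (intro nn_integral_cong) (auto simp: indicator_def)
        also have "\<dots> = ennreal (arcsine_window a (a * (real_of_int n - v)))"
          unfolding a_def using assms by (intro nn_integral_round_Ycoef)
        finally show "(\<integral>\<^sup>+u. indicator B (n, v) * indicator {0::real} (real_of_int (?Q u v) - real_of_int n) \<partial>?U) =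
            ennreal (arcsine_window a (a * (real_of_int n - v))) * indicator B (n, v)"
          by (simp add: mult.commute)
      qed
      finally show "(\<integral>\<^sup>+u. indicator B (?Q u v, v) \<partial>?U) =
          (\<integral>\<^sup>+n. ennreal (arcsine_window a (a * (real_of_int n - v))) * indicator B (n, v) \<partial>?C)" .
    qed
    also have "?V = density lborel (indicator {-1/2..<1/2})"
      by (rule uniform_measure_lborel_unit_interval) simp
    also have "(\<integral>\<^sup>+v. \<integral>\<^sup>+n. ennreal (arcsine_window a (a * (real_of_int n - v))) * indicator B (n, v) \<partial>?C \<partial>density lborel (indicator {-1/2..<1/2})) =
        (\<integral>\<^sup>+v. indicator {-1/2..<1/2} v * (\<integral>\<^sup>+n. ennreal (arcsine_window a (a * (real_of_int n - v))) * indicator B (n, v) \<partial>?C) \<partial>lborel)"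
      by (rule nn_integral_density) measurable
    also have "\<dots> = (\<integral>\<^sup>+v. \<integral>\<^sup>+n. ?p (n, v) * indicator B (n, v) \<partial>?C \<partial>lborel)"
      using a
      by (auto intro!: nn_integral_cong simp: nn_integral_cmult[symmetric] ennreal_mult arcsine_window_nonneg
            ennreal_indicator mult.assoc)
    also have "\<dots> = (\<integral>\<^sup>+(n, v). ?p (n, v) * indicator B (n, v) \<partial>?N)"
    proof -
      have "(\<lambda>(n, v). ?p (n, v) * indicator B (n, v)) \<in> borel_measurable ?N"
        by measurable
      from CL.nn_integral_snd[OF this] show ?thesis
        by simp
    qed
    also have "\<dots> = emeasure (density ?N ?p) B"
      by (subst emeasure_density) (auto simp: case_prod_unfold)
    finally show "emeasure (distr joint_UV ?N ?X) B = emeasure (density ?N ?p) B" .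
  qed simp
  then show ?thesis
    unfolding distributed_def using X p by (auto simp: case_prod_unfold)
qed

lemma Hterm_eq_quantized_entropy:
  assumes "l > 0" "delta_of \<Delta> > 0"
  shows "Hterm \<Delta> l = quantized_entropy (pi * real l * delta_of \<Delta>)"
proof -
  define a where "a = pi * real l * delta_of \<Delta>"
  have a: "a > 0" using assms by (simp add: a_def)
  let ?C = "count_space (UNIV :: int set)"
  let ?I = "indicator {-1/2..<1/2} :: real \<Rightarrow> real"
  define \<phi> where "\<phi> t = arcsine_window a (a * t) * log 2 (arcsine_window a (a * t))" for t
  interpret prob_space joint_UV by (rule prob_space_joint_UV)
  interpret information_space joint_UV 2 by unfold_locales simp
  have [measurable]: "arcsine_window a \<in> borel_measurable borel"
    by (intro borel_measurable_continuous_onI continuous_intros)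
  have [measurable]: "\<phi> \<in> borel_measurable borel"
    unfolding \<phi>_def by measurable
  have "Hterm \<Delta> l = - (\<integral>(n, v). (\<lambda>(n, v). ?I v * arcsine_window a (a * (real_of_int n - v))) (n, v) *
      log 2 ((\<lambda>(n, v). ?I v * arcsine_window a (a * (real_of_int n - v))) (n, v) / ?I v) \<partial>(?C \<Otimes>\<^sub>M lborel))"
    unfolding Hterm_def a_def
    by (rule conditional_entropy_generic_eq[OF sigma_finite_measure_count_space sigma_finite_lborel
          distributed_snd_joint_UV _ distributed_round_Ycoef])
       (use a assms in \<open>auto simp: a_def arcsine_window_nonneg\<close>)
  \<comment> \<open>On the dither interval the ratio of joint to marginal density is the window mass
    itself; off it the leading factor is 0.\<close>
  also have "\<dots> = - (\<integral>z. (case z of (n, v) \<Rightarrow> ?I v) * \<phi> (case z of (n, v) \<Rightarrow> real_of_int n - v) \<partial>(?C \<Otimes>\<^sub>M lborel))"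
    by (intro arg_cong[where f = uminus] Bochner_Integration.integral_cong)
       (auto simp: \<phi>_def indicator_def)
  also have "\<dots> = - (\<integral>z. \<phi> (case z of (n, v) \<Rightarrow> real_of_int n - v) \<partial>density (?C \<Otimes>\<^sub>M lborel) (\<lambda>(n, v). ?I v))"
    by (subst integral_real_density) (auto simp: case_prod_unfold)
  \<comment> \<open>The integrand depends on n - v alone, whose image measure is Lebesgue
    measure.\<close>
  also have "\<dots> = - (\<integral>t. \<phi> t \<partial>distr (density (?C \<Otimes>\<^sub>M lborel) (\<lambda>(n, v). ?I v)) lborel (\<lambda>(n, v). real_of_int n - v))"
    by (subst integral_distr) auto
  also have "\<dots> = - (\<integral>t. \<phi> t \<partial>lborel)"
    using distr_int_minus_unit_interval by (simp add: ennreal_indicator case_prod_unfold)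
  \<comment> \<open>The substitution x = a t produces the division by a.\<close>
  also have "\<dots> = quantized_entropy a"
    using a lborel_integral_real_affine[of a "\<lambda>x. arcsine_window a x * log 2 (arcsine_window a x)" 0]
    by (simp add: quantized_entropy_def \<phi>_def)
  finally show ?thesis by (simp add: a_def)
qed

subsection \<open>The rate\<close>

lemma K_of_eq: "\<Delta> > 0 \<Longrightarrow> K_of \<Delta> = nat \<lceil>2 / (pi\<^sup>2 * \<Delta>)\<rceil>"
  by (simp add: K_of_def D_of_def real_sqrt_divide real_sqrt_mult power2_eq_square mult_ac)

lemma K_of_pos: "\<Delta> > 0 \<Longrightarrow> K_of \<Delta> > 0"
  by (simp add: K_of_eq)

text \<open>The step size is inversely proportional to K, so the l-th window width is a fixed
  constant times l/K, a right-endpoint sample of a K-cell partition of [0, 1].\<close>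

lemma Hbar_eq:
  assumes "\<Delta> > 0"
  shows "Hbar \<Delta> = (\<Sum>l = 1..K_of \<Delta>. quantized_entropy (pi * sqrt (12 * sb_gamma) * (real l / real (K_of \<Delta>))))"
  unfolding Hbar_def
proof (rule sum.cong)
  fix l assume "l \<in> {1..K_of \<Delta>}"
  moreover have "delta_of \<Delta> > 0"
    using K_of_pos[OF assms] sb_gamma_pos by (simp add: delta_of_def)
  ultimately show "Hterm \<Delta> l = quantized_entropy (pi * sqrt (12 * sb_gamma) * (real l / real (K_of \<Delta>)))"
    by (subst Hterm_eq_quantized_entropy) (auto simp: delta_of_def mult_ac)
qed simp

lemma filterlim_K_of: "filterlim K_of sequentially (at_right 0)"
proof -
  have "filterlim (\<lambda>\<Delta>. 2 / (pi\<^sup>2 * \<Delta>)) at_top (at_right 0)"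
    by real_asymp
  then have large: "\<forall>\<^sub>F \<Delta> in at_right 0. real n \<le> 2 / (pi\<^sup>2 * \<Delta>)" for n
    by (simp add: filterlim_at_top)
  have "\<forall>\<^sub>F \<Delta> in at_right 0. n \<le> K_of \<Delta>" for n
    using large[of n] eventually_at_right_less[of 0]
  proof eventually_elim
    case (elim \<Delta>)
    then show ?case unfolding K_of_eq[OF elim(2)] by linarith
  qed
  then show ?thesis
    by (simp add: filterlim_at_top)
qed

text \<open>Rounding up adds at most 1 to 2 / (pi^2 \<Delta>), hence at most \<Delta> after
  multiplication.\<close>

lemma tendsto_mult_K_of: "((\<lambda>\<Delta>. \<Delta> * real (K_of \<Delta>)) \<longlongrightarrow> 2 / pi\<^sup>2) (at_right 0)"
proof (rule tendsto_sandwich[of "\<lambda>_. 2 / pi\<^sup>2" _ _ "\<lambda>\<Delta>. 2 / pi\<^sup>2 + \<Delta>"])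
  have K: "real (K_of \<Delta>) = real_of_int \<lceil>2 / (pi\<^sup>2 * \<Delta>)\<rceil>" if "\<Delta> > 0" for \<Delta>
    using that by (simp add: K_of_eq)
  have 2: "\<Delta> * (2 / (pi\<^sup>2 * \<Delta>)) = 2 / pi\<^sup>2" if "\<Delta> > 0" for \<Delta> :: real
    using that by simp
  show "\<forall>\<^sub>F \<Delta> in at_right 0. 2 / pi\<^sup>2 \<le> \<Delta> * real (K_of \<Delta>)"
    using eventually_at_right_less[of 0]
  proof eventually_elim
    case (elim \<Delta>)
    have "\<Delta> * (2 / (pi\<^sup>2 * \<Delta>)) \<le> \<Delta> * real_of_int \<lceil>2 / (pi\<^sup>2 * \<Delta>)\<rceil>"
      using elim by (intro mult_left_mono le_of_int_ceiling) auto
    then show ?case unfolding K[OF elim] 2[OF elim] .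
  qed
  show "\<forall>\<^sub>F \<Delta> in at_right 0. \<Delta> * real (K_of \<Delta>) \<le> 2 / pi\<^sup>2 + \<Delta>"
    using eventually_at_right_less[of 0]
  proof eventually_elim
    case (elim \<Delta>)
    have "\<Delta> * real_of_int \<lceil>2 / (pi\<^sup>2 * \<Delta>)\<rceil> \<le> \<Delta> * (2 / (pi\<^sup>2 * \<Delta>) + 1)"
      using elim by (intro mult_left_mono of_int_ceiling_le_add_one) auto
    then show ?case unfolding K[OF elim] distrib_left 2[OF elim] by simp
  qed
  show "((\<lambda>\<Delta>. 2 / pi\<^sup>2 + \<Delta>) \<longlongrightarrow> 2 / pi\<^sup>2) (at_right 0)"
    by real_asymp
qed simp

theorem theorem3:
  shows "(\<forall>\<Delta>::real. 0 < \<Delta> \<and> \<Delta> < 1/6 \<longrightarrow>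
           Hbar \<Delta> = (\<Sum>l = 1..K_of \<Delta>.
              diff_entropy (conv arcsine_dens
                 (unif_dens (sqrt (12 * sb_gamma) * pi * real l / real (K_of \<Delta>))))
              - log 2 (pi * real l * sqrt (12 * sb_gamma) / real (K_of \<Delta>))))
       \<and> ((\<lambda>\<Delta>. \<Delta> * Hbar \<Delta>) \<longlongrightarrow>
            (2 / pi^2) * (integral {0..1} (\<lambda>x. diff_entropy (conv arcsine_dens
                 (unif_dens (pi * x * sqrt (12 * sb_gamma)))))
              - log 2 (pi * sqrt (12 * sb_gamma) / exp 1))) (at_right 0)"
proof (intro conjI allI impI)
  define c where "c = pi * sqrt (12 * sb_gamma)"
  have c: "c > 0" using sb_gamma_pos by (simp add: c_def)
  {
    fix \<Delta> :: real assume \<Delta>: "0 < \<Delta> \<and> \<Delta> < 1/6"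
    have "quantized_entropy (c * (real l / real (K_of \<Delta>))) =
        diff_entropy (conv arcsine_dens (unif_dens (sqrt (12 * sb_gamma) * pi * real l / real (K_of \<Delta>))))
        - log 2 (pi * real l * sqrt (12 * sb_gamma) / real (K_of \<Delta>))" if "l \<in> {1..K_of \<Delta>}" for l
    proof -
      have "c * (real l / real (K_of \<Delta>)) > 0"
        using c that by simp
      from diff_entropy_conv_arcsine_unif[OF this] show ?thesis
        by (simp add: c_def mult_ac)
    qed
    then show "Hbar \<Delta> = (\<Sum>l = 1..K_of \<Delta>.
              diff_entropy (conv arcsine_dens
                 (unif_dens (sqrt (12 * sb_gamma) * pi * real l / real (K_of \<Delta>))))
              - log 2 (pi * real l * sqrt (12 * sb_gamma) / real (K_of \<Delta>)))"
      using \<Delta> Hbar_eq[of \<Delta>] by (simp flip: c_def)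
  }
  let ?J = "integral {0..1} (\<lambda>x. diff_entropy (conv arcsine_dens (unif_dens (c * x)))) - log 2 (c / exp 1)"
  let ?S = "\<lambda>n. (\<Sum>l = 1..n. quantized_entropy (c * (real l / real n))) / real n"
  \<comment> \<open>Factors \<Delta> times the sum as (\<Delta> K) times the Riemann mean over K
    cells, where K tends to infinity.\<close>
  have "((\<lambda>\<Delta>. \<Delta> * real (K_of \<Delta>) * ?S (K_of \<Delta>)) \<longlongrightarrow> 2 / pi\<^sup>2 * ?J) (at_right 0)"
    by (intro tendsto_mult tendsto_mult_K_of
        filterlim_compose[OF riemann_sums_quantized_entropy[OF c] filterlim_K_of])
  moreover have "\<forall>\<^sub>F \<Delta> in at_right 0. \<Delta> * real (K_of \<Delta>) * ?S (K_of \<Delta>) = \<Delta> * Hbar \<Delta>"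
    using eventually_at_right_less[of 0]
  proof eventually_elim
    case (elim \<Delta>)
    then show ?case
      using K_of_pos[OF elim] by (simp add: Hbar_eq flip: c_def)
  qed
  ultimately have "((\<lambda>\<Delta>. \<Delta> * Hbar \<Delta>) \<longlongrightarrow> 2 / pi\<^sup>2 * ?J) (at_right 0)"
    by (rule Lim_transform_eventually)
  then show "((\<lambda>\<Delta>. \<Delta> * Hbar \<Delta>) \<longlongrightarrow>
            (2 / pi^2) * (integral {0..1} (\<lambda>x. diff_entropy (conv arcsine_dens
                 (unif_dens (pi * x * sqrt (12 * sb_gamma)))))
              - log 2 (pi * sqrt (12 * sb_gamma) / exp 1))) (at_right 0)"
    by (simp add: c_def mult_ac)
qed

end
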